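(* The independence polynomial $I(T;x)$ of every well-covered spider $T$ is unimodal. Moreover, for every integer $n\ge 2$, $$I(S_n;x)=(1+x)\cdot\left\{1+\sum_{k=1}^{n}\left[\binom{n}{k}\cdot 2^{k}+\binom{n-1}{k-1}\right]\cdot x^{k}\right\},$$ and the mode of $I(S_n;x)$ is unique and equals $$1+\big((n-1)\bmod 3\big)+2\left(\left\lceil n/3\right\rceil-1\right).$$
   Context: All graphs are finite, undirected, without loops or multiple edges. A stable set of a graph $G$ is a set of pairwise non-adjacent vertices; $\alpha(G)$ is the maximum size of a stable set. If $s_k$ is the number of stable sets of size $k$ in $G$ (with $s_0=1$), the independence polynomial of $G$ is $I(G;x)=\sum_{k=0}^{\alpha(G)}s_kx^k$. A finite sequence of non-negative real numbers $(a_0,a_1,\dots,a_n)$ is unimodal if there is $k\in\{0,\dots,n\}$, called the mode, with $a_0\le a_1\le\dots\le a_k\ge a_{k+1}\ge\dots\ge a_n$; the mode is unique if $a_{k-1}<a_k>a_{k+1}$. A polynomial is unimodal if its sequence of coefficients is unimodal, and its mode is the mode of that sequence. A graph is well-covered if all its (inclusion-)maximal stable sets have the same cardinality. A spider is a tree having at most one vertex of degree $\ge 3$. For $n\ge 2$, $S_n$ denotes the well-covered spider having one vertex of degree $n+1$, $n$ vertices of degree $2$ and $n+1$ vertices of degree $1$; explicitly, $V(S_n)=\{a_0,\dots,a_n,b_0,\dots,b_n\}$ and $E(S_n)=\{a_ib_i:0\le i\le n\}\cup\{b_0b_i:1\le i\le n\}$. *)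

theory Defs
  imports
    Complex_Main
    "HOL-Computational_Algebra.Polynomial"
    "Graph_Theory.Graph_Theory"
begin

text \<open>
  A finite simple undirected graph is a \<^locale>\<open>pair_graph\<close>: a finite symmetric loop-free
  digraph without parallel arcs, in which an edge between \<open>u\<close> and \<open>v\<close> is the pair of
  arcs \<open>(u, v)\<close> and \<open>(v, u)\<close>.
\<close>

definition stable_set :: "'a pair_pre_digraph \<Rightarrow> 'a set \<Rightarrow> bool" where
  "stable_set G S \<longleftrightarrow> S \<subseteq> pverts G \<and> (\<forall>u\<in>S. \<forall>v\<in>S. (u, v) \<notin> parcs G)"

definition stability_number :: "'a pair_pre_digraph \<Rightarrow> nat" where
  "stability_number G = Max {card S | S. stable_set G S}"

definition num_stable_sets :: "'a pair_pre_digraph \<Rightarrow> nat \<Rightarrow> nat" where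
  "num_stable_sets G k = card {S. stable_set G S \<and> card S = k}"

definition independence_poly :: "'a pair_pre_digraph \<Rightarrow> real poly" where
  "independence_poly G = (\<Sum>k\<le>stability_number G. monom (real (num_stable_sets G k)) k)"

definition maximal_stable_set :: "'a pair_pre_digraph \<Rightarrow> 'a set \<Rightarrow> bool" where
  "maximal_stable_set G S \<longleftrightarrow> stable_set G S \<and> (\<forall>S'. stable_set G S' \<and> S \<subseteq> S' \<longrightarrow> S' = S)"

definition well_covered :: "'a pair_pre_digraph \<Rightarrow> bool" where
  "well_covered G \<longleftrightarrow>
     (\<forall>S S'. maximal_stable_set G S \<and> maximal_stable_set G S' \<longrightarrow> card S = card S')"

text \<open>
  The library predicate \<^const>\<open>tree\<close> forbids all directed cycles, and in a symmetric digraph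
  every edge gives a directed cycle of length 2. The cycles of the undirected graph are the
  directed ones of length at least 3. Connectedness includes non-emptiness.
\<close>

definition undirected_tree :: "'a pair_pre_digraph \<Rightarrow> bool" where
  "undirected_tree G \<longleftrightarrow>
     pair_graph G \<and> connected (with_proj G) \<and>
     \<not> (\<exists>p. pre_digraph.cycle (with_proj G) p \<and> 3 \<le> length p)"

text \<open>In a \<^locale>\<open>pair_graph\<close> the out-degree of a vertex is its degree.\<close>

definition spider :: "'a pair_pre_digraph \<Rightarrow> bool" where
  "spider G \<longleftrightarrow>
     undirected_tree G \<and> card {v \<in> pverts G. 3 \<le> out_degree (with_proj G) v} \<le> 1"

datatype spider_vertex = VA nat | VB nat

definition spider_S :: "nat \<Rightarrow> spider_vertex pair_pre_digraph" where
  "spider_S n =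
     (let E = {(VA i, VB i) | i. i \<le> n} \<union> {(VB 0, VB i) | i. 1 \<le> i \<and> i \<le> n}
      in \<lparr> pverts = VA ` {..n} \<union> VB ` {..n}, parcs = E \<union> E\<inverse> \<rparr>)"

lemma pair_graph_spider_S: "pair_graph (spider_S n)"
proof -
  have "finite (pverts (spider_S n))"
    by (auto simp: spider_S_def Let_def)
  moreover have sub: "parcs (spider_S n) \<subseteq> pverts (spider_S n) \<times> pverts (spider_S n)"
    by (auto simp: spider_S_def Let_def)
  ultimately have "finite (parcs (spider_S n))"
    by (meson finite_SigmaI finite_subset)
  with \<open>finite (pverts (spider_S n))\<close> sub show ?thesis
    by unfold_locales (auto simp: spider_S_def Let_def symmetric_def sym_def)
qed

text \<open>
  The finite sequence \<open>a 0, \<dots>, a n\<close> is given by a function together with its last index \<open>n\<close>.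
\<close>

definition is_mode :: "(nat \<Rightarrow> real) \<Rightarrow> nat \<Rightarrow> nat \<Rightarrow> bool" where
  "is_mode a n k \<longleftrightarrow>
     (\<forall>i\<le>n. 0 \<le> a i) \<and> k \<le> n \<and>
     (\<forall>i<k. a i \<le> a (Suc i)) \<and>
     (\<forall>i. k \<le> i \<and> i < n \<longrightarrow> a (Suc i) \<le> a i)"

definition unimodal :: "(nat \<Rightarrow> real) \<Rightarrow> nat \<Rightarrow> bool" where
  "unimodal a n \<longleftrightarrow> (\<exists>k. is_mode a n k)"

text \<open>At an end of the sequence, the comparison with the missing neighbour is dropped.\<close>

definition is_unique_mode :: "(nat \<Rightarrow> real) \<Rightarrow> nat \<Rightarrow> nat \<Rightarrow> bool" where
  "is_unique_mode a n k \<longleftrightarrow>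
     is_mode a n k \<and> (0 < k \<longrightarrow> a (k - 1) < a k) \<and> (k < n \<longrightarrow> a (k + 1) < a k)"

definition unimodal_poly :: "real poly \<Rightarrow> bool" where
  "unimodal_poly p \<longleftrightarrow> unimodal (coeff p) (degree p)"

definition is_unique_mode_poly :: "real poly \<Rightarrow> nat \<Rightarrow> bool" where
  "is_unique_mode_poly p k \<longleftrightarrow> is_unique_mode (coeff p) (degree p) k"

end

theory Submission
  imports Defs
begin

text \<open>
  Apart from a single vertex, every well-covered spider consists of a centre \<open>c\<close>, one leaf
  attached to \<open>c\<close>, and some number \<open>n \<ge> 0\<close> of legs of length 2. Splitting the stable sets
  according to whether they contain \<open>c\<close> then gives the closed form
  \<open>(1 + x) (1 + 2 x)^n + x (1 + x)^n\<close>: without \<open>c\<close> the graph is one isolated vertex and \<open>n\<close>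
  disjoint edges, and a stable set containing \<open>c\<close> is free to use the \<open>n\<close> outer ends of the legs.

  For the structure, take \<open>c\<close> of maximum degree, so that all other vertices have degree at most 2,
  and consider a path that ends in \<open>c\<close> and cannot be prolonged at its other end; as there are no
  cycles, that end is a leaf (\<open>far_end_leaf\<close>). If the path had four or more vertices, one could
  replace two vertices of a maximal stable set by a single one between them and obtain a smaller
  maximal stable set; the only graph that escapes this is the path on four vertices, and there
  \<open>c\<close> would have to be an end (\<open>well_covered_no_long_leg\<close>). Hence all legs have length 1 or 2.
  Let \<open>L\<close> be the set of leaves adjacent to \<open>c\<close>, let \<open>B\<close> be the set of neighbours of \<open>c\<close> on legs
  of length 2 and \<open>A\<close> that of their outer ends. If \<open>c\<close> has a neighbour, both \<open>{c} \<union> A\<close> and \<open>L \<union> B\<close> are maximal stable sets;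
  no stable set is larger than these, and comparing them with the stable sets \<open>L \<union> A\<close> and \<open>{c} \<union> A\<close>
  gives \<open>card L \<le> 1\<close> and \<open>card L \<ge> 1\<close> (\<open>well_covered_spider_structure\<close>).

  For the mode, clearing denominators in the difference of two consecutive coefficients leaves an
  expression whose sign is that of \<open>4 m (m + 1) - k (k + 1)\<close> with \<open>m = n - k\<close>
  (\<open>spider_poly_increment\<close>). Consequently the coefficients increase strictly
  from \<open>k\<close> to \<open>k + 1\<close> if \<open>3 k \<le> 2 n\<close>, and decrease strictly otherwise, so the unique mode is
  \<open>2 n div 3 + 1\<close>.
\<close>

section \<open>Generating functions of stable sets\<close>

text \<open>
  This is the independence polynomial of the subgraph induced on \<open>V\<close>, summed over the stable sets
  themselves. Keeping the vertex set separate from the edge relation makes vertex deletion a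
  recursion on \<open>V\<close> alone.
\<close>

definition stable_gf :: "('a \<times> 'a) set \<Rightarrow> 'a set \<Rightarrow> real poly" where
  "stable_gf E V = (\<Sum>S | S \<subseteq> V \<and> (\<forall>u\<in>S. \<forall>v\<in>S. (u, v) \<notin> E). monom 1 (card S))"

lemma stable_set_finite:
  assumes "finite (pverts G)"
  shows "finite {S. stable_set G S}"
  by (rule finite_subset[of _ "Pow (pverts G)"]) (use assms in \<open>auto simp: stable_set_def\<close>)

lemma card_stable_set_le:
  assumes "finite (pverts G)" "stable_set G S"
  shows "card S \<le> stability_number G"
  unfolding stability_number_def
  using assms stable_set_finite[OF assms(1)] by (intro Max_ge) auto

lemma independence_poly_eq_stable_gf:
  assumes "finite (pverts G)"
  shows "independence_poly G = stable_gf (parcs G) (pverts G)"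
proof -
  have "stable_gf (parcs G) (pverts G) = (\<Sum>S | stable_set G S. monom 1 (card S))"
    by (simp add: stable_gf_def stable_set_def)
  also have "\<dots> = (\<Sum>k\<le>stability_number G. \<Sum>S | S \<in> {S. stable_set G S} \<and> card S = k. monom 1 (card S))"
    using assms by (intro sum.group[symmetric]) (auto simp: stable_set_finite card_stable_set_le)
  also have "\<dots> = independence_poly G"
    unfolding independence_poly_def
    by (intro sum.cong refl) (simp add: num_stable_sets_def of_nat_poly smult_monom)
  finally show ?thesis by simp
qed

lemma stable_gf_empty [simp]: "stable_gf E {} = 1"
proof -
  have "{S. S \<subseteq> {} \<and> (\<forall>u\<in>S. \<forall>v\<in>S. (u, v) \<notin> E)} = {{}}" by auto
  then show ?thesis by (simp add: stable_gf_def)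
qed

text \<open>
  The stable sets of \<open>insert v V\<close> either avoid \<open>v\<close>, or consist of \<open>v\<close> and a stable set among
  the non-neighbours of \<open>v\<close>.
\<close>

lemma stable_gf_insert:
  assumes fin: "finite V" and v: "v \<notin> V" and "sym E" and "(v, v) \<notin> E"
  shows "stable_gf E (insert v V) = stable_gf E V + [:0, 1:] * stable_gf E (V - E `` {v})"
proof -
  define F where "F W = {S. S \<subseteq> W \<and> (\<forall>u\<in>S. \<forall>v\<in>S. (u, v) \<notin> E)}" for W
  have gf: "stable_gf E W = (\<Sum>S\<in>F W. monom 1 (card S))" for W
    by (simp add: stable_gf_def F_def)
  have finF: "finite (F W)" if "finite W" for W
    by (rule finite_subset[of _ "Pow W"]) (use that in \<open>auto simp: F_def\<close>)
  have split: "F (insert v V) = F V \<union> insert v ` F (V - E `` {v})"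
  proof (intro equalityI subsetI)
    fix S assume S: "S \<in> F (insert v V)"
    show "S \<in> F V \<union> insert v ` F (V - E `` {v})"
    proof (cases "v \<in> S")
      case True
      then have "S - {v} \<in> F (V - E `` {v})" "S = insert v (S - {v})"
        using S by (auto simp: F_def)
      then show ?thesis by blast
    next
      case False
      then show ?thesis using S by (auto simp: F_def)
    qed
  next
    fix S assume "S \<in> F V \<union> insert v ` F (V - E `` {v})"
    then show "S \<in> F (insert v V)"
      using assms(3,4) by (auto simp: F_def dest: symD)
  qed
  have inj: "inj_on (insert v) (F (V - E `` {v}))"
    using v by (intro inj_onI) (auto simp: F_def insert_ident)
  have card: "card (insert v S) = Suc (card S)" if "S \<in> F (V - E `` {v})" for S
    using that v fin by (intro card_insert_disjoint) (auto simp: F_def intro: finite_subset)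
  have "stable_gf E (insert v V)
      = (\<Sum>S\<in>F V. monom 1 (card S)) + (\<Sum>S\<in>insert v ` F (V - E `` {v}). monom 1 (card S))"
    unfolding gf split using fin v by (intro sum.union_disjoint) (auto simp: finF F_def)
  also have "(\<Sum>S\<in>insert v ` F (V - E `` {v}). monom (1::real) (card S))
      = (\<Sum>S\<in>F (V - E `` {v}). [:0, 1:] * monom 1 (card S))"
    unfolding sum.reindex[OF inj] by (intro sum.cong) (auto simp: card monom_Suc)
  finally show ?thesis by (simp add: gf sum_distrib_left)
qed

lemma stable_gf_independent:
  assumes "finite A" "sym E" "\<And>u v. u \<in> A \<Longrightarrow> v \<in> A \<Longrightarrow> (u, v) \<notin> E"
  shows "stable_gf E A = [:1, 1:] ^ card A"
  using assms
proof (induction A rule: finite_induct)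
  case (insert v A)
  have "A - E `` {v} = A" using insert.prems by auto
  moreover have "[:1, 1:] * p = p + [:0, 1:] * p" for p :: "real poly" by simp
  ultimately show ?case
    using insert by (simp add: stable_gf_insert)
qed simp

text \<open>
  Each of the disjoint edges contributes the factor \<open>1 + 2 x\<close>: neither or exactly one of its two
  ends is chosen.
\<close>

lemma stable_gf_matching:
  assumes "finite B" "sym E" "inj_on a B" "B \<inter> a ` B = {}"
    "\<And>b v. b \<in> B \<Longrightarrow> v \<in> B \<union> a ` B \<Longrightarrow> (b, v) \<in> E \<longleftrightarrow> v = a b"
    "\<And>b v. b \<in> B \<Longrightarrow> v \<in> B \<union> a ` B \<Longrightarrow> (a b, v) \<in> E \<longleftrightarrow> v = b"
  shows "stable_gf E (B \<union> a ` B) = [:1, 2:] ^ card B"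
  using assms
proof (induction B rule: finite_induct)
  case (insert b B)
  let ?W = "B \<union> a ` B"
  have W: "finite ?W" "b \<notin> ?W" "a b \<notin> insert b ?W"
    using insert.hyps insert.prems(2,3) by auto
  have 1: "?W - E `` {a b} = ?W"
    using insert.prems(5)[of b] W by auto
  have 2: "insert (a b) ?W - E `` {b} = ?W"
  proof -
    have "(b, v) \<in> E \<longleftrightarrow> v = a b" if "v \<in> insert (a b) ?W" for v
      using insert.prems(4)[of b v] that by auto
    then have "insert (a b) ?W - E `` {b} = insert (a b) ?W - {a b}"
      by (intro set_eqI) (simp add: Image_iff conj_ac cong: conj_cong)
    also have "\<dots> = ?W" using W(3) by (intro Diff_insert_absorb) blast
    finally show ?thesis .
  qed
  have loops: "(b, b) \<notin> E" "(a b, a b) \<notin> E"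
    using insert.prems(4)[of b b] insert.prems(5)[of b "a b"] W by auto
  have IH: "stable_gf E ?W = [:1, 2:] ^ card B"
    using insert.prems by (intro insert.IH) auto
  have "insert b B \<union> a ` insert b B = insert b (insert (a b) ?W)" by auto
  moreover have "stable_gf E (insert b (insert (a b) ?W))
      = stable_gf E (insert (a b) ?W) + [:0, 1:] * stable_gf E (insert (a b) ?W - E `` {b})"
    by (rule stable_gf_insert) (use W loops \<open>sym E\<close> in auto)
  moreover have "stable_gf E (insert (a b) ?W) = stable_gf E ?W + [:0, 1:] * stable_gf E (?W - E `` {a b})"
    by (rule stable_gf_insert) (use W loops \<open>sym E\<close> in auto)
  ultimately have "stable_gf E (insert b B \<union> a ` insert b B)
      = stable_gf E ?W + [:0, 1:] * stable_gf E ?W + [:0, 1:] * stable_gf E ?W"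
    unfolding 1 2 by simp
  also have "\<dots> = (1 + [:0, 1:] + [:0, 1:]) * stable_gf E ?W"
    by (simp only: distrib_right mult_1_left)
  also have "1 + [:0, 1:] + [:0, 1:] = [:1, 2 :: real:]" by (simp add: one_pCons)
  finally show ?case using IH insert.hyps by simp
qed simp

section \<open>Spiders in which every vertex lies on a pendant edge\<close>

text \<open>
  The centre is \<open>c\<close>, its leaf is \<open>l\<close>, and each \<open>b \<in> B\<close> is the middle of a leg with outer end
  \<open>a b\<close>. Empty \<open>B\<close> gives a single edge, a singleton gives the path on four vertices.
\<close>

definition pendant_spider :: "'a pair_pre_digraph \<Rightarrow> 'a \<Rightarrow> 'a \<Rightarrow> 'a set \<Rightarrow> ('a \<Rightarrow> 'a) \<Rightarrow> bool" where
  "pendant_spider G c l B a \<longleftrightarrow>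
     finite B \<and> inj_on a B \<and> B \<inter> a ` B = {} \<and>
     c \<noteq> l \<and> c \<notin> B \<union> a ` B \<and> l \<notin> B \<union> a ` B \<and>
     pverts G = insert c (insert l (B \<union> a ` B)) \<and>
     parcs G `` {c} = insert l B \<and> parcs G `` {l} = {c} \<and>
     (\<forall>b\<in>B. parcs G `` {b} = {c, a b} \<and> parcs G `` {a b} = {b})"

text \<open>
  The two summands count the stable sets that avoid the centre and those that contain it.
\<close>

definition spider_poly :: "nat \<Rightarrow> real poly" where
  "spider_poly n = [:1, 1:] * [:1, 2:] ^ n + [:0, 1:] * [:1, 1:] ^ n"

lemma independence_poly_pendant_spider:
  assumes G: "pair_graph G" and shape: "pendant_spider G c l B a"
  shows "independence_poly G = spider_poly (card B)"
proof -
  interpret pair_graph G by fact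
  let ?E = "parcs G" and ?W = "B \<union> a ` B"
  have symE: "sym ?E" using arcs_symmetric by (auto intro: symI)
  have sh: "finite B" "inj_on a B" "B \<inter> a ` B = {}"
     "c \<noteq> l" "c \<notin> ?W" "l \<notin> ?W"
     "pverts G = insert c (insert l ?W)"
     "?E `` {c} = insert l B" "?E `` {l} = {c}"
     and Nb: "\<And>b. b \<in> B \<Longrightarrow> ?E `` {b} = {c, a b}"
     and Na: "\<And>b. b \<in> B \<Longrightarrow> ?E `` {a b} = {b}"
    using shape unfolding pendant_spider_def by auto
  have b_iff: "(b, v) \<in> ?E \<longleftrightarrow> v = c \<or> v = a b" if "b \<in> B" for b v
    using Nb[OF that] by auto
  have a_iff: "(a b, v) \<in> ?E \<longleftrightarrow> v = b" if "b \<in> B" for b v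
    using Na[OF that] by auto
  have noloop: "(v, v) \<notin> ?E" for v using no_loops' by blast
  have gfW: "stable_gf ?E ?W = [:1, 2:] ^ card B"
    using sh by (intro stable_gf_matching symE) (auto simp: a_iff b_iff)
  have "stable_gf ?E (insert l ?W) = stable_gf ?E ?W + [:0, 1:] * stable_gf ?E (?W - ?E `` {l})"
    using sh by (intro stable_gf_insert symE noloop) auto
  also have "?W - ?E `` {l} = ?W" using sh by auto
  finally have gfl: "stable_gf ?E (insert l ?W) = [:1, 1:] * [:1, 2:] ^ card B"
    by (simp add: gfW)
  have rest: "insert l ?W - ?E `` {c} = a ` B"
    unfolding sh(8) using sh(3,6) by blast
  have "stable_gf ?E (a ` B) = [:1, 1:] ^ card (a ` B)"
  proof (intro stable_gf_independent symE)
    fix u v assume "u \<in> a ` B" "v \<in> a ` B"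
    then obtain b where b: "u = a b" "b \<in> B" by blast
    then have "v \<noteq> b" using \<open>v \<in> a ` B\<close> sh(3) by blast
    then show "(u, v) \<notin> ?E" using b by (simp add: a_iff)
  qed (use sh(1) in simp)
  then have gfa: "stable_gf ?E (a ` B) = [:1, 1:] ^ card B"
    using sh by (simp add: card_image)
  have "independence_poly G = stable_gf ?E (insert c (insert l ?W))"
    using independence_poly_eq_stable_gf[OF pair_finite_verts] unfolding sh(7) .
  also have "\<dots> = stable_gf ?E (insert l ?W) + [:0, 1:] * stable_gf ?E (insert l ?W - ?E `` {c})"
    using sh by (intro stable_gf_insert symE noloop) auto
  also have "\<dots> = spider_poly (card B)"
    unfolding rest gfl gfa spider_poly_def ..
  finally show ?thesis .
qed

lemma pendant_spider_spider_S:
  "pendant_spider (spider_S n) (VB 0) (VA 0) (VB ` {1..n}) (\<lambda>v. case v of VB i \<Rightarrow> VA i | VA i \<Rightarrow> VA i)"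
proof -
  have split: "{..n} = insert 0 {1..n}" by auto
  have img: "(\<lambda>v. case v of VB i \<Rightarrow> VA i | VA i \<Rightarrow> VA i) ` VB ` {1..n} = VA ` {1..n}"
    by (simp add: image_image)
  show ?thesis
    unfolding pendant_spider_def img
    by (auto simp: spider_S_def Let_def split inj_on_def)
qed

corollary independence_poly_spider_S: "independence_poly (spider_S n) = spider_poly n"
  using independence_poly_pendant_spider[OF pair_graph_spider_S pendant_spider_spider_S]
  by (simp add: card_image inj_on_def)

section \<open>The coefficients of the spider polynomial\<close>

lemma coeff_linear_power_choose: "coeff ([:1, c:] ^ n) k = real (n choose k) * c ^ k"
proof (cases "k \<le> n")
  case True
  then show ?thesis by (simp add: coeff_linear_poly_power)
next
  case False
  have "degree ([:1, c:] ^ n) \<le> n"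
    using degree_power_le[of "[:1, c:]" n] by (simp split: if_splits)
  then show ?thesis using False by (simp add: coeff_eq_0)
qed

lemma coeff_spider_poly_0: "coeff (spider_poly n) 0 = 1"
  using coeff_linear_power_choose[of 2 n 0] by (simp add: spider_poly_def)

lemma coeff_spider_poly_Suc:
  "coeff (spider_poly n) (Suc k)
    = real (n choose Suc k) * 2 ^ Suc k + real (n choose k) * (2 ^ k + 1)"
  using coeff_linear_power_choose[of 2 n] coeff_linear_power_choose[of 1 n]
  by (simp add: spider_poly_def algebra_simps)

lemma degree_spider_poly: "degree (spider_poly n) = Suc n"
proof (rule antisym)
  show "degree (spider_poly n) \<le> Suc n"
  proof (rule degree_le, intro allI impI)
    fix i assume "Suc n < i"
    then obtain j where "i = Suc j" "n < j" by (cases i) auto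
    then show "coeff (spider_poly n) i = 0"
      by (simp add: coeff_spider_poly_Suc binomial_eq_0)
  qed
  have "coeff (spider_poly n) (Suc n) > 0"
    by (simp add: coeff_spider_poly_Suc binomial_eq_0 add_pos_pos)
  then show "Suc n \<le> degree (spider_poly n)"
    by (intro le_degree) simp
qed

text \<open>
  The factor \<open>1 + x\<close> can be split off because \<open>n \<ge> 1\<close> lets \<open>x (1 + x)^n\<close> lose one factor.
\<close>

lemma spider_poly_factorization:
  assumes "1 \<le> n"
  shows "spider_poly n = [:1, 1:] * (1 + (\<Sum>k = 1..n.
           monom (real ((n choose k) * 2 ^ k + ((n - 1) choose (k - 1)))) k))"
proof -
  obtain m where n: "n = Suc m" using assms by (cases n) auto
  have eq: "1 + (\<Sum>k = 1..n. monom (real ((n choose k) * 2 ^ k + ((n - 1) choose (k - 1)))) k)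
      = [:1, 2:] ^ n + [:0, 1:] * [:1, 1:] ^ m" (is "?Q = _")
  proof (rule poly_eqI)
    fix k
    show "coeff ?Q k = coeff ([:1, 2:] ^ n + [:0, 1:] * [:1, 1:] ^ m) k"
    proof (cases k)
      case 0
      then show ?thesis
        using coeff_linear_power_choose[of 2 n 0] by (simp add: coeff_sum)
    next
      case (Suc j)
      have "coeff ?Q k = (\<Sum>i = 1..n. if i = k then real ((n choose i) * 2 ^ i + (m choose (i - 1))) else 0)"
        using Suc n by (simp only: coeff_add coeff_sum coeff_monom) simp
      also have "\<dots> = real ((n choose k) * 2 ^ k + (m choose j))"
        using Suc n by (cases "k \<le> n") (simp_all add: sum.delta binomial_eq_0)
      finally show ?thesis
        using Suc coeff_linear_power_choose[of 2 n] coeff_linear_power_choose[of 1 m] by simp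
    qed
  qed
  have "spider_poly n = [:1, 1:] * [:1, 2:] ^ n + [:0, 1:] * ([:1, 1:] * [:1, 1:] ^ m)"
    by (simp only: spider_poly_def n power_Suc)
  also have "\<dots> = [:1, 1:] * ([:1, 2:] ^ n + [:0, 1:] * [:1, 1:] ^ m)"
    by (simp only: distrib_left mult.left_commute)
  finally show ?thesis
    unfolding eq .
qed

text \<open>
  With \<open>k = j + 1\<close> and \<open>m = n - k\<close>, the binomial coefficients \<open>n choose (j + 1)\<close> and
  \<open>n choose (j + 2)\<close> are rational multiples of \<open>n choose j\<close> by absorption; the factor
  \<open>(j + 1) (j + 2)\<close> clears the denominators.
\<close>

lemma spider_poly_increment:
  assumes n: "n = m + Suc j"
  shows "real ((j + 1) * (j + 2)) * (coeff (spider_poly n) (Suc (Suc j)) - coeff (spider_poly n) (Suc j))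
    = real (n choose j) * (2 ^ j * (4 * real m * (real m + 1) - (real j + 1) * (real j + 2))
        + (real j + 2) * (real m - real j))"
proof -
  define x y z where "x = real (n choose j)" and "y = real (n choose Suc j)"
    and "z = real (n choose Suc (Suc j))"
  have "Suc j * (n choose Suc j) = (n - j) * (n choose j)"
    using binomial_absorb_comp[of n j] binomial_absorption[of j n] by simp
  then have "real (Suc j) * y = real (n - j) * x"
    unfolding x_def y_def by (metis of_nat_mult)
  then have y: "(real j + 1) * y = (real m + 1) * x"
    using n by (simp add: algebra_simps)
  have "Suc (Suc j) * (n choose Suc (Suc j)) = (n - Suc j) * (n choose Suc j)"
    using binomial_absorb_comp[of n "Suc j"] binomial_absorption[of "Suc j" n] by simp
  then have "real (Suc (Suc j)) * z = real (n - Suc j) * y"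
    unfolding z_def y_def by (metis of_nat_mult)
  then have z: "(real j + 2) * z = real m * y"
    using n by (simp add: algebra_simps)
  have yz: "(real j + 1) * ((real j + 2) * z) = real m * ((real m + 1) * x)"
    using y z by algebra
  have "real ((j + 1) * (j + 2)) * (coeff (spider_poly n) (Suc (Suc j)) - coeff (spider_poly n) (Suc j))
     = (real j + 1) * (real j + 2) * (z * (4 * 2 ^ j) + y - x * (2 ^ j + 1))"
    unfolding coeff_spider_poly_Suc x_def y_def z_def by (simp add: algebra_simps)
  also have "\<dots> = 4 * 2 ^ j * ((real j + 1) * ((real j + 2) * z)) + (real j + 2) * ((real j + 1) * y)
     - (real j + 1) * (real j + 2) * (2 ^ j + 1) * x"
    by (simp add: algebra_simps)
  also have "\<dots> = x * (2 ^ j * (4 * real m * (real m + 1) - (real j + 1) * (real j + 2))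
        + (real j + 2) * (real m - real j))"
    unfolding yz y by (simp add: algebra_simps)
  finally show ?thesis by (simp add: x_def)
qed

text \<open>
  In the increment formula, \<open>k \<le> 2 m\<close> makes the bracket \<open>4 m (m + 1) - k (k + 1)\<close> at least
  \<open>2 m\<close>. Together with \<open>2^j \<ge> j + 1\<close> this outweighs the second summand, which is negative for
  \<open>j > m\<close>.
\<close>

lemma spider_poly_coeff_less:
  assumes "3 * k \<le> 2 * n"
  shows "coeff (spider_poly n) k < coeff (spider_poly n) (Suc k)"
proof (cases k)
  case 0
  then show ?thesis
    by (simp add: coeff_spider_poly_0 coeff_spider_poly_Suc)
next
  case (Suc j)
  define m where "m = n - k"
  have n: "n = m + Suc j" and jm: "j + 1 \<le> 2 * m" using assms Suc by (auto simp: m_def)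
  define X J M where "X = (2::real) ^ j" and "J = real j" and "M = real m"
  have J: "0 \<le> J" "J + 1 \<le> 2 * M" "0 < M"
    using jm unfolding J_def M_def by linarith+
  have X: "X \<ge> J + 1"
    using Bernoulli_inequality[of "1::real" j] by (simp add: X_def J_def)
  have "(J + 1) * (J + 2) \<le> (2 * M) * (2 * M + 1)"
    using J by (intro mult_mono) auto
  then have "2 * M \<le> 4 * M * (M + 1) - (J + 1) * (J + 2)"
    by (simp add: algebra_simps)
  then have "(J + 1) * (2 * M) \<le> X * (4 * M * (M + 1) - (J + 1) * (J + 2))"
    using X J by (intro mult_mono) auto
  moreover have "(J + 2) * (J - M) \<le> (J + 2) * (M - 1)"
    using J by (intro mult_left_mono) auto
  moreover have "0 < J * M + J + 2" using J by (intro add_nonneg_pos add_nonneg_nonneg) auto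
  ultimately have "0 < X * (4 * M * (M + 1) - (J + 1) * (J + 2)) + (J + 2) * (M - J)"
    by (simp add: algebra_simps)
  moreover have "0 < real (n choose j)" using n by simp
  ultimately have "0 < real ((j + 1) * (j + 2)) * (coeff (spider_poly n) (Suc (Suc j)) - coeff (spider_poly n) (Suc j))"
    unfolding spider_poly_increment[OF n] X_def J_def M_def by (rule mult_pos_pos[rotated])
  then show ?thesis
    unfolding Suc by (subst (asm) zero_less_mult_iff) (simp del: of_nat_mult)
qed

text \<open>
  In the increment formula, \<open>k \<ge> 2 m + 1\<close> makes the bracket negative and the second summand
  non-positive.
\<close>

lemma spider_poly_coeff_greater:
  assumes "k \<le> n" "2 * n < 3 * k"
  shows "coeff (spider_poly n) (Suc k) < coeff (spider_poly n) k"
proof -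
  obtain j where k: "k = Suc j" using assms by (cases k) auto
  define m where "m = n - k"
  have n: "n = m + Suc j" and jm: "2 * m \<le> j" using assms k by (auto simp: m_def)
  define X J M where "X = (2::real) ^ j" and "J = real j" and "M = real m"
  have J: "0 \<le> M" "2 * M \<le> J" "0 \<le> J"
    using jm unfolding J_def M_def by linarith+
  have X: "0 < X" by (simp add: X_def)
  have "(2 * M) * (2 * M + 2) \<le> J * (J + 2)"
    using J by (intro mult_mono) auto
  then have "4 * M * (M + 1) - (J + 1) * (J + 2) < 0"
    using J by (simp add: algebra_simps)
  then have "X * (4 * M * (M + 1) - (J + 1) * (J + 2)) < 0"
    using X by (rule mult_pos_neg[rotated])
  moreover have "(J + 2) * (M - J) \<le> 0"
    using J by (intro mult_nonneg_nonpos) auto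
  ultimately have "X * (4 * M * (M + 1) - (J + 1) * (J + 2)) + (J + 2) * (M - J) < 0"
    by linarith
  moreover have "0 < real (n choose j)" using n by simp
  ultimately have "real ((j + 1) * (j + 2)) * (coeff (spider_poly n) (Suc (Suc j)) - coeff (spider_poly n) (Suc j)) < 0"
    unfolding spider_poly_increment[OF n] X_def J_def M_def by (rule mult_pos_neg[rotated])
  then show ?thesis
    unfolding k by (subst (asm) mult_less_0_iff) (simp del: of_nat_mult)
qed

proposition spider_poly_unique_mode: "is_unique_mode_poly (spider_poly n) (2 * n div 3 + 1)"
proof -
  let ?k = "2 * n div 3 + 1"
  have nonneg: "0 \<le> coeff (spider_poly n) i" for i
    by (cases i) (auto simp: coeff_spider_poly_0 coeff_spider_poly_Suc)
  have up: "coeff (spider_poly n) i < coeff (spider_poly n) (Suc i)" if "i < ?k" for i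
    using that by (intro spider_poly_coeff_less) linarith
  have down: "coeff (spider_poly n) (Suc i) < coeff (spider_poly n) i" if "?k \<le> i" "i < Suc n" for i
    using that by (intro spider_poly_coeff_greater) linarith+
  have "?k \<le> Suc n" by linarith
  then show ?thesis
    unfolding is_unique_mode_poly_def is_unique_mode_def is_mode_def degree_spider_poly
    using nonneg up down by (auto intro: less_imp_le)
qed

text \<open>
  Writing \<open>n = 3 q + r + 1\<close> with \<open>r < 3\<close>, both sides are \<open>2 q + r + 1\<close>.
\<close>

lemma mode_formula:
  assumes "1 \<le> n"
  shows "1 + (n - 1) mod 3 + 2 * (nat \<lceil>real n / 3\<rceil> - 1) = 2 * n div 3 + 1"
proof -
  define q r where "q = (n - 1) div 3" and "r = (n - 1) mod 3"
  have n: "n = 3 * q + r + 1" and r: "r < 3"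
    using assms unfolding q_def r_def by auto
  have "\<lceil>real n / 3\<rceil> = int q + 1"
    using r unfolding n by (intro ceiling_unique) (auto simp: field_simps)
  then have "1 + (n - 1) mod 3 + 2 * (nat \<lceil>real n / 3\<rceil> - 1) = 1 + r + 2 * q"
    by (simp add: r_def)
  also have "\<dots> = 2 * n div 3 + 1"
    using r unfolding n by presburger
  finally show ?thesis .
qed

section \<open>Paths in trees\<close>

text \<open>
  Paths are lists of vertices whose head is the far end, so that prolonging a leg outwards is
  consing and a path from the centre has the centre as its last element.
\<close>

definition simple_path :: "'a pair_pre_digraph \<Rightarrow> 'a list \<Rightarrow> bool" where
  "simple_path G xs \<longleftrightarrow> distinct xs \<and> set xs \<subseteq> pverts G \<and> successively (\<lambda>u v. (u, v) \<in> parcs G) xs"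

lemma awalk_of_vertices:
  assumes "pair_wf_digraph G" "set (u # xs) \<subseteq> pverts G"
    "successively (\<lambda>u v. (u, v) \<in> parcs G) (u # xs)"
  shows "\<exists>p. pre_digraph.awalk (with_proj G) u p (last (u # xs)) \<and> pawalk_verts u p = u # xs"
  using assms(2,3)
proof (induction xs arbitrary: u)
  case Nil
  interpret pair_wf_digraph G by fact
  show ?case using Nil by (intro exI[of _ "[]"]) (auto simp: awalk_def)
next
  case (Cons v xs)
  interpret pair_wf_digraph G by fact
  obtain p where "awalk v p (last (v # xs))" "pawalk_verts v p = v # xs"
    using Cons.IH[of v] Cons.prems by (auto simp: successively_Cons)
  then show ?case
    using Cons.prems by (intro exI[of _ "(u, v) # p"]) (auto simp: awalk_Cons_iff)
qed

text \<open>
  The path \<open>x, y, zs, w\<close> has at least three vertices, so an edge between its two ends would close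
  it to a cycle of length at least 3.
\<close>

lemma tree_no_chord:
  assumes tree: "undirected_tree G" and path: "simple_path G (x # y # zs @ [w])"
  shows "(x, w) \<notin> parcs G"
proof
  assume "(x, w) \<in> parcs G"
  interpret pair_graph G using tree by (simp add: undirected_tree_def)
  have arc: "(w, x) \<in> parcs G" using arcs_symmetric \<open>(x, w) \<in> parcs G\<close> .
  obtain p where p: "awalk w p (last (w # x # y # zs @ [w]))"
      "pawalk_verts w p = w # x # y # zs @ [w]"
    using awalk_of_vertices[OF pair_wf_digraph, of w "x # y # zs @ [w]"] path arc
    by (auto simp: simple_path_def successively_Cons)
  have "length (pawalk_verts u p) = Suc (length p)" for u
    by (induction p arbitrary: u) auto
  from this[of w] have "length p = length zs + 3" using p(2) by simp
  moreover have "cycle p"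
    unfolding cycle_def using p path calculation by (intro exI[of _ w]) (auto simp: simple_path_def)
  ultimately show False using tree unfolding undirected_tree_def by auto
qed

text \<open>
  A neighbour of the far end \<open>x\<close> lies on the path, since otherwise it would prolong it; but an
  edge back to a vertex beyond \<open>y\<close> would be a chord.
\<close>

lemma far_end_leaf:
  assumes tree: "undirected_tree G" and path: "simple_path G (x # y # zs)"
    and max: "\<And>w. \<not> simple_path G (w # x # y # zs)"
  shows "parcs G `` {x} = {y}"
proof
  interpret pair_graph G using tree by (simp add: undirected_tree_def)
  show "parcs G `` {x} \<subseteq> {y}"
  proof
    fix w assume "w \<in> parcs G `` {x}"
    then have xw: "(x, w) \<in> parcs G" by simp
    then have wx: "(w, x) \<in> parcs G" by (rule arcs_symmetric)
    have "w \<in> set (x # y # zs)"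
      using max[of w] path wx by (auto simp: simple_path_def dest: in_arcsD1)
    moreover have "w \<noteq> x" using no_loops' xw by blast
    moreover have "w \<notin> set zs"
    proof
      assume "w \<in> set zs"
      then obtain us vs where zs: "zs = us @ w # vs" by (meson split_list)
      then have "simple_path G ((x # y # us @ [w]) @ vs)" using path by simp
      then have "simple_path G (x # y # us @ [w])"
        unfolding simple_path_def by (simp only: successively_append_iff distinct_append set_append) simp
      then show False using tree_no_chord[OF tree] xw by blast
    qed
    ultimately show "w \<in> {y}" by auto
  qed
  show "{y} \<subseteq> parcs G `` {x}" using path by (auto simp: simple_path_def)
qed

lemma simple_path_extension:
  assumes fin: "finite (pverts G)" and path: "simple_path G xs"
  shows "\<exists>ys. simple_path G (ys @ xs) \<and> (\<forall>w. \<not> simple_path G (w # ys @ xs))"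
proof -
  have bound: "length (ys @ xs) \<le> card (pverts G)" if "simple_path G (ys @ xs)" for ys
    using that fin unfolding simple_path_def by (metis card_mono distinct_card)
  obtain ys where ys: "simple_path G (ys @ xs)"
      "\<And>zs. simple_path G (zs @ xs) \<Longrightarrow> length zs \<le> length ys"
    using ex_has_greatest_nat[of "\<lambda>ys. simple_path G (ys @ xs)" "[]" length "Suc (card (pverts G))"]
      path bound by fastforce
  show ?thesis
    using ys(1) ys(2)[of "_ # ys"] by fastforce
qed

section \<open>Well-covered spiders\<close>

lemma stable_set_extension:
  assumes "finite (pverts G)" "stable_set G S"
  shows "\<exists>M. maximal_stable_set G M \<and> S \<subseteq> M"
proof -
  have "\<exists>M\<in>{S. stable_set G S}. S \<subseteq> M \<and> (\<forall>T\<in>{S. stable_set G S}. M \<subseteq> T \<longrightarrow> M = T)"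
    using finite_has_maximal2[of "{S. stable_set G S}" S] stable_set_finite[of G] assms by auto
  then show ?thesis unfolding maximal_stable_set_def by blast
qed

text \<open>
  A stable set extends to a maximal one, and all of these have the same size.
\<close>

lemma well_covered_card_le:
  assumes "well_covered G" "finite (pverts G)" "maximal_stable_set G M" "stable_set G S"
  shows "card S \<le> card M"
proof -
  obtain M' where M': "maximal_stable_set G M'" "S \<subseteq> M'"
    using stable_set_extension assms by blast
  then have "finite M'"
    using assms(2) by (auto simp: maximal_stable_set_def stable_set_def intro: finite_subset)
  then show ?thesis
    using M' assms(1,3) unfolding well_covered_def by (metis card_mono)
qed

lemma maximal_stable_setI:
  assumes "stable_set G M" "\<And>v. v \<in> pverts G \<Longrightarrow> v \<notin> M \<Longrightarrow> \<exists>u\<in>M. (u, v) \<in> parcs G"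
  shows "maximal_stable_set G M"
  unfolding maximal_stable_set_def
proof (intro conjI allI impI)
  fix S' assume S': "stable_set G S' \<and> M \<subseteq> S'"
  show "S' = M"
  proof (rule ccontr)
    assume "S' \<noteq> M"
    then obtain v where "v \<in> S'" "v \<notin> M" using S' by auto
    then show False using S' assms(2)[of v] unfolding stable_set_def by blast
  qed
qed fact

lemma maximal_stable_set_dominates:
  assumes G: "pair_graph G" and M: "maximal_stable_set G M" and v: "v \<in> pverts G" "v \<notin> M"
  shows "\<exists>u\<in>M. (u, v) \<in> parcs G"
proof (rule ccontr)
  interpret pair_graph G by fact
  assume undominated: "\<not> ?thesis"
  have stM: "stable_set G M" and maxM: "\<And>S. stable_set G S \<Longrightarrow> M \<subseteq> S \<Longrightarrow> S = M"
    using M by (auto simp: maximal_stable_set_def)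
  have "(u, v) \<notin> parcs G" "(v, u) \<notin> parcs G" if "u \<in> M" for u
    using that undominated arcs_symmetric[of v u] by auto
  moreover have "(v, v) \<notin> parcs G" using no_loops'[of v v] by auto
  ultimately have "stable_set G (insert v M)"
    using stM v(1) by (auto simp: stable_set_def)
  then have "insert v M = M" by (rule maxM) blast
  then show False using v(2) by blast
qed

text \<open>
  Let \<open>x1, x2, x3\<close> be the outer part of a leg that is attached to \<open>x4\<close>. If \<open>x4\<close> had another
  neighbour \<open>x5\<close>, then a maximal stable set containing \<open>x1\<close>, \<open>x3\<close> and \<open>x5\<close> would stay maximal
  when \<open>x1\<close> and \<open>x3\<close> are replaced by \<open>x2\<close>: the only vertex that might become free is \<open>x4\<close>,
  and \<open>x5\<close> blocks it. So \<open>x4\<close> is a leaf and the component is a path on four vertices.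
\<close>

lemma well_covered_no_long_leg:
  assumes G: "pair_graph G" and wc: "well_covered G"
    and N1: "parcs G `` {x1} = {x2}" and N2: "parcs G `` {x2} = {x1, x3}"
    and N3: "parcs G `` {x3} = {x2, x4}" and dist: "distinct [x1, x2, x3, x4]"
  shows "parcs G `` {x4} \<subseteq> {x3}"
proof (rule ccontr)
  interpret pair_graph G by fact
  assume "\<not> ?thesis"
  then obtain x5 where x45: "(x4, x5) \<in> parcs G" and x53: "x5 \<noteq> x3" by auto
  have E1: "(x1, v) \<in> parcs G \<longleftrightarrow> v = x2" for v using N1 by auto
  have E2: "(x2, v) \<in> parcs G \<longleftrightarrow> v = x1 \<or> v = x3" for v using N2 by auto
  have E3: "(x3, v) \<in> parcs G \<longleftrightarrow> v = x2 \<or> v = x4" for v using N3 by auto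
  have sym: "(u, v) \<in> parcs G \<longleftrightarrow> (v, u) \<in> parcs G" for u v using arcs_symmetric by blast
  have noloop: "(v, v) \<notin> parcs G" for v using no_loops' by blast
  have x5: "x5 \<noteq> x1" "x5 \<noteq> x2" "x5 \<noteq> x4"
    using x45 E1[of x4] E2[of x4] sym[of x4 x5] noloop[of x4] dist by auto
  have "x1 \<in> pverts G" "x3 \<in> pverts G" "x5 \<in> pverts G"
    using E1[of x2] E3[of x2] x45 in_arcsD1 in_arcsD2 by blast+
  then have "stable_set G {x1, x3, x5}"
    using E1 E3 sym noloop x5 dist x53 unfolding stable_set_def by auto
  then obtain M where M: "maximal_stable_set G M" and sub: "{x1, x3, x5} \<subseteq> M"
    using stable_set_extension[OF pair_finite_verts] by blast
  have stM: "stable_set G M" using M by (simp add: maximal_stable_set_def)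
  have finM: "finite M"
    using stM pair_finite_verts unfolding stable_set_def by (blast intro: finite_subset)
  have x2M: "x2 \<notin> M" using stM sub E1[of x2] unfolding stable_set_def by auto
  have x2V: "x2 \<in> pverts G" using E1[of x2] in_arcsD2 by blast
  define M' where "M' = insert x2 (M - {x1, x3})"
  have "maximal_stable_set G M'"
  proof (rule maximal_stable_setI)
    have "(x2, u) \<notin> parcs G \<and> (u, x2) \<notin> parcs G" if "u \<in> M - {x1, x3}" for u
      using that E2[of u] sym[of u x2] by simp
    then show "stable_set G M'"
      using stM noloop[of x2] x2V unfolding stable_set_def M'_def by auto
  next
    fix v assume v: "v \<in> pverts G" "v \<notin> M'"
    show "\<exists>u\<in>M'. (u, v) \<in> parcs G"
    proof (cases "v = x1 \<or> v = x3")
      case True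
      then show ?thesis using E2 unfolding M'_def by blast
    next
      case False
      then have "v \<notin> M" using v by (auto simp: M'_def)
      then obtain u where u: "u \<in> M" "(u, v) \<in> parcs G"
        using maximal_stable_set_dominates[OF G M v(1)] by blast
      show ?thesis
      proof (cases "u = x1 \<or> u = x3")
        case True
        then have "v = x4" using u E1 E3 v by (auto simp: M'_def)
        moreover have "x5 \<in> M'" using sub x5 x53 by (auto simp: M'_def)
        ultimately show ?thesis using x45 sym by blast
      next
        case False
        then show ?thesis using u by (auto simp: M'_def)
      qed
    qed
  qed
  then have "card M \<le> card M'"
    using well_covered_card_le[OF wc pair_finite_verts _ stM] by blast
  moreover have "card (M - {x1, x3}) = card M - 2"
    using sub dist by (subst card_Diff_subset) auto
  moreover have "2 \<le> card M"
    using card_mono[OF finM, of "{x1, x3}"] sub dist by simp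
  ultimately show False
    using finM x2M by (simp add: M'_def)
qed

lemma out_degree_with_proj: "out_degree (with_proj G) v = card (parcs G `` {v})"
proof -
  have "out_arcs (with_proj G) v = Pair v ` (parcs G `` {v})"
    by (auto simp: out_arcs_def)
  then show ?thesis by (simp add: out_degree_def card_image inj_on_def)
qed

text \<open>
  Any vertex of maximum degree will do. Maximality matters when there is no vertex of degree 3 or
  more, that is, for paths: it keeps the centre away from the ends if there are at least three
  vertices.
\<close>

lemma spider_center:
  assumes "spider G"
  obtains c where "c \<in> pverts G"
    "\<And>v. v \<in> pverts G \<Longrightarrow> card (parcs G `` {v}) \<le> card (parcs G `` {c})"
    "\<And>v. v \<in> pverts G \<Longrightarrow> v \<noteq> c \<Longrightarrow> card (parcs G `` {v}) \<le> 2"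
proof -
  have tree: "undirected_tree G"
    and one: "card {v \<in> pverts G. 3 \<le> card (parcs G `` {v})} \<le> 1"
    using assms by (auto simp: spider_def out_degree_with_proj)
  interpret pair_graph G using tree by (simp add: undirected_tree_def)
  let ?deg = "\<lambda>v. card (parcs G `` {v})"
  have "strongly_connected (with_proj G)"
    using tree symmetric_connected_imp_strongly_connected pair_sym_arcs
    by (simp add: undirected_tree_def)
  then have "pverts G \<noteq> {}" by (simp add: strongly_connected_def)
  then have "Max (?deg ` pverts G) \<in> ?deg ` pverts G"
    using pair_finite_verts by (intro Max_in) auto
  then obtain c where c: "Max (?deg ` pverts G) = ?deg c" "c \<in> pverts G"
    by (rule imageE)
  have max: "?deg v \<le> ?deg c" if "v \<in> pverts G" for v
    unfolding c(1)[symmetric] using that pair_finite_verts by (intro Max_ge) auto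
  have "card (parcs G `` {v}) \<le> 2" if "v \<in> pverts G" "v \<noteq> c" for v
  proof (rule ccontr)
    assume "\<not> ?thesis"
    then have "{v, c} \<subseteq> {v \<in> pverts G. 3 \<le> card (parcs G `` {v})}"
      using c(2) max[of v] that by auto
    from card_mono[OF _ this] show False using one that pair_finite_verts by simp
  qed
  then show thesis using that[OF c(2) max] by simp
qed

lemma connected_closed_set:
  assumes G: "pair_graph G" and "connected (with_proj G)" and "c \<in> S" "c \<in> pverts G"
    and closed: "\<And>u v. u \<in> S \<Longrightarrow> (u, v) \<in> parcs G \<Longrightarrow> v \<in> S"
  shows "pverts G \<subseteq> S"
proof
  interpret pair_graph G by fact
  fix v assume "v \<in> pverts G"
  have "strongly_connected (with_proj G)"
    using symmetric_connected_imp_strongly_connected[OF _ assms(2)] pair_sym_arcs by simp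
  then have "c \<rightarrow>\<^sup>*\<^bsub>with_proj G\<^esub> v"
    using \<open>v \<in> pverts G\<close> \<open>c \<in> pverts G\<close> by (auto simp: strongly_connected_def)
  then have "(c, v) \<in> (parcs G)\<^sup>*"
    using reachable_rtranclI[of "with_proj G" c v] by simp
  then show "v \<in> S" using \<open>c \<in> S\<close>
    by (induction rule: rtrancl_induct) (auto intro: closed)
qed

lemma card_2_eq:
  assumes "finite N" "card N \<le> 2" "x \<in> N" "y \<in> N" "x \<noteq> y"
  shows "N = {x, y}"
  using card_seteq[of N "{x, y}"] assms by auto

theorem well_covered_spider_structure:
  assumes wc: "well_covered G" and sp: "spider G"
  shows "(\<exists>c. pverts G = {c}) \<or> (\<exists>c l B a. pendant_spider G c l B a)"
proof -
  have tree: "undirected_tree G" using sp by (simp add: spider_def)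
  have G: "pair_graph G" and conn: "connected (with_proj G)"
    using tree by (simp_all add: undirected_tree_def)
  interpret pair_graph G by fact
  obtain c where c: "c \<in> pverts G"
    and degc: "\<And>v. v \<in> pverts G \<Longrightarrow> card (parcs G `` {v}) \<le> card (parcs G `` {c})"
    and deg2: "\<And>v. v \<in> pverts G \<Longrightarrow> v \<noteq> c \<Longrightarrow> card (parcs G `` {v}) \<le> 2"
    using spider_center[OF sp] by blast
  have sym: "(u, v) \<in> parcs G \<longleftrightarrow> (v, u) \<in> parcs G" for u v using arcs_symmetric by blast
  have noloop: "(v, v) \<notin> parcs G" for v using no_loops' by blast
  have finN: "finite (parcs G `` {v})" for v
    by (rule finite_subset[OF _ pair_finite_verts]) (auto dest: in_arcsD2)
  have N2: "parcs G `` {v} = {x, y}"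
    if "v \<noteq> c" "(v, x) \<in> parcs G" "(v, y) \<in> parcs G" "x \<noteq> y" for v x y
    using card_2_eq[OF finN deg2, of v x y] that in_arcsD1 by auto

  \<comment> \<open>The outer three vertices of a longer path would form a leg to which the exchange argument applies.\<close>
  have short: "length xs \<le> 3" if path: "simple_path G xs" and last: "xs \<noteq> []" "last xs = c" for xs
  proof (rule ccontr)
    assume long: "\<not> length xs \<le> 3"
    obtain ys where ys: "simple_path G (ys @ xs)" "\<And>w. \<not> simple_path G (w # ys @ xs)"
      using simple_path_extension[OF pair_finite_verts path] by blast
    obtain x1 x2 x3 x4 zs where eq: "ys @ xs = x1 # x2 # x3 # x4 # zs"
      using long by (metis Suc_le_length_iff length_append not_less_eq_eq numeral_3_eq_3 trans_le_add2)
    have lastc: "last (x4 # zs) = c" using last eq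
      by (metis last_ConsR last_appendR list.distinct(1))
    have dist: "distinct (x1 # x2 # x3 # x4 # zs)"
      and arcs: "(x1, x2) \<in> parcs G" "(x2, x3) \<in> parcs G" "(x3, x4) \<in> parcs G"
        "successively (\<lambda>u v. (u, v) \<in> parcs G) (x4 # zs)"
      using ys(1) unfolding eq by (auto simp: simple_path_def)
    have ne: "x2 \<noteq> c" "x3 \<noteq> c"
      using dist lastc last_in_set[of "x4 # zs"] by auto
    have E1: "parcs G `` {x1} = {x2}"
      using far_end_leaf[OF tree] ys unfolding eq by blast
    have E2: "parcs G `` {x2} = {x1, x3}" using N2[OF ne(1)] arcs sym dist by auto
    have E3: "parcs G `` {x3} = {x2, x4}" using N2[OF ne(2)] arcs sym dist by auto
    have E4: "parcs G `` {x4} \<subseteq> {x3}"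
      using well_covered_no_long_leg[OF G wc E1 E2 E3] dist by auto
    show False
    proof (cases zs)
      \<comment> \<open>The leg \<open>x1, x2, x3\<close> would be attached to a centre of degree 1, against its maximum degree.\<close>
      case Nil
      then have "x4 = c" using lastc by simp
      then have "card (parcs G `` {x2}) \<le> card (parcs G `` {x4})"
        using degc arcs(1) in_arcsD2 by blast
      also have "\<dots> \<le> 1" using card_mono[OF _ E4] by simp
      finally show False using E2 dist by simp
    next
      case (Cons x5 zs')
      then show False using E4 arcs(4) dist by auto
    qed
  qed

  define N where "N = parcs G `` {c}"
  have cN: "c \<notin> N" using noloop by (auto simp: N_def)
  \<comment> \<open>A path of three vertices ending in the centre cannot be prolonged.\<close>
  have leaf: "parcs G `` {x} = {b}" if "b \<in> N" "(b, x) \<in> parcs G" "x \<noteq> c" for b x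
  proof (rule far_end_leaf[OF tree, of _ _ "[c]"])
    show "simple_path G [x, b, c]"
      using that sym noloop c cN in_arcsD2[of b x] in_arcsD2[of c b]
      by (auto simp: simple_path_def N_def)
    show "\<not> simple_path G (w # x # b # [c])" for w
      using short[of "[w, x, b, c]"] by auto
  qed
  \<comment> \<open>The neighbours of the centre on legs of length 2 and of length 1, respectively.\<close>
  define B L where "B = {b \<in> N. parcs G `` {b} \<noteq> {c}}" and "L = {b \<in> N. parcs G `` {b} = {c}}"
  have "\<exists>x. x \<noteq> c \<and> (b, x) \<in> parcs G" if "b \<in> B" for b
    using that sym by (auto simp: B_def N_def)
  then obtain a where a: "\<And>b. b \<in> B \<Longrightarrow> a b \<noteq> c \<and> (b, a b) \<in> parcs G" by metis
  have Nb: "parcs G `` {b} = {c, a b}" if "b \<in> B" for b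
    using N2[of b c "a b"] a[OF that] that cN sym by (auto simp: B_def N_def)
  have Na: "parcs G `` {a b} = {b}" if "b \<in> B" for b
    using leaf[of b "a b"] a[OF that] that by (auto simp: B_def)
  have Nc: "parcs G `` {c} = L \<union> B" by (auto simp: L_def B_def N_def)
  have Nl: "parcs G `` {l} = {c}" if "l \<in> L" for l using that by (simp add: L_def)
  have Ec: "(c, v) \<in> parcs G \<longleftrightarrow> v \<in> L \<union> B" for v using Nc by auto
  have Eb: "(b, v) \<in> parcs G \<longleftrightarrow> v = c \<or> v = a b" if "b \<in> B" for b v using Nb[OF that] by auto
  have Ea: "(a b, v) \<in> parcs G \<longleftrightarrow> v = b" if "b \<in> B" for b v using Na[OF that] by auto
  have El: "(l, v) \<in> parcs G \<longleftrightarrow> v = c" if "l \<in> L" for l v using Nl[OF that] by auto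
  have verts: "pverts G = insert c (L \<union> B \<union> a ` B)"
  proof
    show "pverts G \<subseteq> insert c (L \<union> B \<union> a ` B)"
      by (rule connected_closed_set[OF G conn, of c]) (use c in \<open>auto simp: Ec Eb Ea El\<close>)
    show "insert c (L \<union> B \<union> a ` B) \<subseteq> pverts G"
      using c a Ec in_arcsD2 by blast
  qed
  have fin: "finite L" "finite B" using pair_finite_verts unfolding verts by auto
  have inj: "inj_on a B" using Na by (metis inj_onI singleton_inject)
  have LB: "L \<inter> B = {}" by (auto simp: L_def B_def)
  have aLB: "a b \<notin> L \<union> B" if "b \<in> B" for b
    using Ec[of "a b"] sym[of c "a b"] Ea[OF that] that cN by (auto simp: B_def)
  have cLB: "c \<notin> L" "c \<notin> B" "c \<notin> a ` B" using cN a by (auto simp: L_def B_def)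
  show ?thesis
  proof (cases "L \<union> B = {}")
    case True
    then show ?thesis using verts by auto
  next
    case False
    \<comment> \<open>The first two are moreover maximal: the first bounds the size of the third, the second that of the first.\<close>
    have st: "stable_set G (insert c (a ` B))" "stable_set G (L \<union> B)" "stable_set G (L \<union> a ` B)"
      using verts cLB aLB LB noloop
      by (auto simp: stable_set_def Ec Eb Ea El)
    have "maximal_stable_set G (insert c (a ` B))"
      by (rule maximal_stable_setI[OF st(1)]) (auto simp: verts Ec)
    then have "card (L \<union> a ` B) \<le> card (insert c (a ` B))"
      using well_covered_card_le[OF wc pair_finite_verts] st by blast
    moreover have "card (L \<union> a ` B) = card L + card B"
      using fin aLB inj by (subst card_Un_disjoint) (auto simp: card_image)
    moreover have card_ca: "card (insert c (a ` B)) = Suc (card B)"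
      using fin cLB inj by (simp add: card_image)
    ultimately have le: "card L \<le> 1" by simp
    have "maximal_stable_set G (L \<union> B)"
    proof (rule maximal_stable_setI[OF st(2)])
      fix v assume v: "v \<in> pverts G" "v \<notin> L \<union> B"
      obtain u where u: "u \<in> L \<union> B" using False by blast
      show "\<exists>u\<in>L \<union> B. (u, v) \<in> parcs G"
      proof (cases "v = c")
        case True
        then have "(u, v) \<in> parcs G" using u El Eb by auto
        then show ?thesis using u by blast
      next
        case False
        then obtain b where "b \<in> B" "v = a b" using v verts by auto
        then have "b \<in> L \<union> B" "(b, v) \<in> parcs G" using Eb by auto
        then show ?thesis by blast
      qed
    qed
    then have "card (insert c (a ` B)) \<le> card (L \<union> B)"
      using well_covered_card_le[OF wc pair_finite_verts] st by blast
    also have "\<dots> = card L + card B" using fin LB by (simp add: card_Un_disjoint)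
    finally have "card L = 1" using le card_ca by simp
    then obtain l where l: "L = {l}" by (auto simp: card_1_singleton_iff)
    have "pendant_spider G c l B a"
      unfolding pendant_spider_def
      using fin inj aLB cLB LB Nb Na Nc Nl verts l by auto
    then show ?thesis by blast
  qed
qed

lemma independence_poly_singleton:
  assumes "pair_graph G" "pverts G = {c}"
  shows "independence_poly G = [:1, 1:]"
proof -
  interpret pair_graph G by fact
  have "(u, v) \<notin> parcs G" if "u \<in> {c}" "v \<in> {c}" for u v
    using that no_loops' by blast
  moreover have "sym (parcs G)" using arcs_symmetric by (auto intro: symI)
  ultimately show ?thesis
    using stable_gf_independent[of "{c}" "parcs G"]
    by (simp add: independence_poly_eq_stable_gf assms(2))
qed

theorem well_covered_spider_unimodal:
  assumes "well_covered G" "spider G"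
  shows "unimodal_poly (independence_poly G)"
proof -
  have G: "pair_graph G" using assms(2) by (simp add: spider_def undirected_tree_def)
  consider (point) c where "pverts G = {c}" | (star) c l B a where "pendant_spider G c l B a"
    using well_covered_spider_structure[OF assms] by blast
  then show ?thesis
  proof cases
    case point
    have "is_mode (coeff [:1, 1:]) (degree [:1, 1 :: real:]) 0"
      by (auto simp: is_mode_def coeff_pCons split: nat.splits)
    then show ?thesis
      unfolding unimodal_poly_def unimodal_def independence_poly_singleton[OF G point] by blast
  next
    case star
    then show ?thesis
      using spider_poly_unique_mode
      unfolding independence_poly_pendant_spider[OF G star] unimodal_poly_def unimodal_def
        is_unique_mode_poly_def is_unique_mode_def by blast
  qed
qed

theorem theorem3p1:
  shows "(\<forall>T :: 'a pair_pre_digraph. well_covered T \<and> spider T \<longrightarrow>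
            unimodal_poly (independence_poly T)) \<and>
         (\<forall>n :: nat. 2 \<le> n \<longrightarrow>
            independence_poly (spider_S n) =
              [:1, 1:] * (1 + (\<Sum>k = 1..n.
                 monom (real ((n choose k) * 2 ^ k + ((n - 1) choose (k - 1)))) k)) \<and>
            is_unique_mode_poly (independence_poly (spider_S n))
              (1 + (n - 1) mod 3 + 2 * (nat \<lceil>real n / 3\<rceil> - 1)))"
proof (intro conjI allI impI)
  fix T :: "'a pair_pre_digraph"
  assume "well_covered T \<and> spider T"
  then show "unimodal_poly (independence_poly T)"
    using well_covered_spider_unimodal by blast
next
  fix n :: nat assume "2 \<le> n"
  then show "independence_poly (spider_S n) =
      [:1, 1:] * (1 + (\<Sum>k = 1..n.
         monom (real ((n choose k) * 2 ^ k + ((n - 1) choose (k - 1)))) k))"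
    unfolding independence_poly_spider_S by (intro spider_poly_factorization) simp
next
  fix n :: nat assume "2 \<le> n"
  then have "1 \<le> n" by simp
  show "is_unique_mode_poly (independence_poly (spider_S n))
      (1 + (n - 1) mod 3 + 2 * (nat \<lceil>real n / 3\<rceil> - 1))"
    unfolding independence_poly_spider_S mode_formula[OF \<open>1 \<le> n\<close>]
    by (rule spider_poly_unique_mode)
qed

end
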